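(* Let $Y$ be a finite-volume hyperbolic 3-manifold, let $S$ be a finite symmetric generating set of $G=\pi_1(Y)$, and let $\boldsymbol{\rho}\colon S\to \mathrm{GL}_2(\mathrm{I}\mathbb{C})$ be an approximate holonomy representation for $Y$. Suppose $s_1,s_2\in S$ satisfy $2\notin \operatorname{tr}\big(\boldsymbol{\rho}([s_1,s_2])\big)$. If $w$ is a word in $S$ with $$\big|\operatorname{tr}^2(\boldsymbol{\rho}(w))-4\big|+\big|\operatorname{tr}\big([\boldsymbol{\rho}(s_i),\boldsymbol{\rho}(w)]\big)-2\big|<1$$ for each $i=1,2$, then $w=1$ in $G$.
   Context: All 3-manifolds are orientable. $\mathrm{I}\mathbb{C}$ denotes the set of complex intervals: closed rectangles in $\mathbb{C}$ (sides parallel to the axes) with vertices in $\mathbb{Q}(i)$, each regarded as a partial specification of an unknown complex number lying in it. Complex intervals are combined by interval arithmetic: the result of an operation ($+,-,\times,/$) on intervals is an interval containing all results of applying the operation to numbers in the input intervals (division requires that the denominator interval not contain $0$); absolute values similarly give real intervals. $M_2(\mathrm{I}\mathbb{C})$ is the set of $2\times2$ matrices with entries in $\mathrm{I}\mathbb{C}$, with the induced interval addition, multiplication, trace, determinant (and inverse where defined); $\mathrm{GL}_2(\mathrm{I}\mathbb{C})$ is the subset of those whose determinant interval does not contain $0$. A matrix $A\in M_2(\mathbb{C})$ lies in $\mathbf{A}\in M_2(\mathrm{I}\mathbb{C})$ if each entry of $A$ lies in the corresponding entry of $\mathbf{A}$. A holonomy representation of $G=\pi_1(Y)$ is a lift $\rho_0\colon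 G\to\mathrm{SL}_2(\mathbb{C})$ of a holonomy representation $G\to\mathrm{Isom}^+(\mathbb{H}^3)=\mathrm{PSL}_2(\mathbb{C})$ of the complete hyperbolic structure on $Y$. An approximate holonomy representation is a function $\boldsymbol{\rho}\colon S\to\mathrm{GL}_2(\mathrm{I}\mathbb{C})$ for which there exists a holonomy representation $\rho_0\colon G\to\mathrm{SL}_2(\mathbb{C})$ with $\rho_0(\gamma)\in\boldsymbol{\rho}(\gamma)$ for all $\gamma\in S$. For a word $w=t_1t_2\cdots t_n$ in $S$, $\boldsymbol{\rho}(w)=\boldsymbol{\rho}(t_1)\boldsymbol{\rho}(t_2)\cdots\boldsymbol{\rho}(t_n)$, computed in interval arithmetic in $M_2(\mathrm{I}\mathbb{C})$; thus $\rho_0(w)\in\boldsymbol{\rho}(w)$. Here $[a,b]=aba^{-1}b^{-1}$, $\operatorname{tr}^2(A)=(\operatorname{tr}A)^2$, and the left-hand side of the displayed inequality is a real interval; the inequality means that both of its endpoints are less than $1$. *)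

theory Defs
  imports
    "HOL-Analysis.Analysis"
    "HOL-Algebra.Generated_Groups"
    "HOL-Library.Interval"
begin

section \<open>The fundamental group\<close>

definition loops :: "'a::topological_space set \<Rightarrow> 'a \<Rightarrow> (real \<Rightarrow> 'a) set" where
  "loops Y y0 = {g. path g \<and> path_image g \<subseteq> Y \<and> pathstart g = y0 \<and> pathfinish g = y0}"

definition loop_class :: "'a::topological_space set \<Rightarrow> (real \<Rightarrow> 'a) \<Rightarrow> (real \<Rightarrow> 'a) set" where
  "loop_class Y g = {h. homotopic_paths Y g h}"

text \<open>The product of two classes is the class of \<open>g +++ h\<close>, i.e. first \<open>g\<close>, then \<open>h\<close>.\<close>

definition fundamental_group :: "'a::topological_space set \<Rightarrow> 'a \<Rightarrow> (real \<Rightarrow> 'a) set monoid" where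
  "fundamental_group Y y0 =
     \<lparr> carrier = loop_class Y ` loops Y y0,
       mult = (\<lambda>a b. {k. \<exists>g\<in>a. \<exists>h\<in>b. homotopic_paths Y (g +++ h) k}),
       one = loop_class Y (\<lambda>_. y0) \<rparr>"

definition symmetric_generating_set :: "('g, 'b) monoid_scheme \<Rightarrow> 'g set \<Rightarrow> bool" where
  "symmetric_generating_set G S \<longleftrightarrow>
     S \<subseteq> carrier G \<and> (\<forall>s\<in>S. inv\<^bsub>G\<^esub> s \<in> S) \<and> generate G S = carrier G"

definition word_value :: "('g, 'b) monoid_scheme \<Rightarrow> 'g list \<Rightarrow> 'g" where
  "word_value G w = foldr (\<lambda>s x. s \<otimes>\<^bsub>G\<^esub> x) w \<one>\<^bsub>G\<^esub>"


section \<open>Hyperbolic 3-space and its orientation-preserving isometries\<close>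

text \<open>
  The upper half-space model \<open>{(z, t). t > 0}\<close>, with the metric \<open>(|dz|^2 + dt^2) / t^2\<close>
  and hence the volume element \<open>1 / t^3\<close>.
\<close>

definition H3 :: "(complex \<times> real) set" where
  "H3 = {x. snd x > 0}"

definition hyperbolic_volume :: "(complex \<times> real) set \<Rightarrow> ennreal" where
  "hyperbolic_volume B = (\<integral>\<^sup>+x\<in>B. ennreal (1 / snd x ^ 3) \<partial>lborel)"

definition SL2C :: "(complex^2^2) monoid" where
  "SL2C = \<lparr> carrier = {M. det M = 1}, mult = (**), one = mat 1 \<rparr>"

text \<open>
  The Poincare extension of the Moebius transformation \<open>z \<mapsto> (a z + b) / (c z + d)\<close> with
  \<open>a d - b c = 1\<close>.  Two matrices in \<open>SL(2,C)\<close> give the same map iff they agree up to sign, and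
  the maps so obtained are exactly the orientation-preserving isometries of \<open>H3\<close>; this is the
  identification of that group with \<open>PSL(2,C)\<close>.
\<close>

definition SL2C_action :: "complex^2^2 \<Rightarrow> complex \<times> real \<Rightarrow> complex \<times> real" where
  "SL2C_action M x =
     (let a = M$1$1; b = M$1$2; c = M$2$1; d = M$2$2; z = fst x; t = snd x;
          n = (cmod (c * z + d))\<^sup>2 + (cmod c)\<^sup>2 * t\<^sup>2
      in (((a * z + b) * cnj (c * z + d) + a * cnj c * complex_of_real (t\<^sup>2)) / complex_of_real n,
          t / n))"


section \<open>Finite-volume hyperbolic 3-manifolds\<close>

text \<open>
  A hyperbolic structure is an atlas modelled on \<open>H3\<close> whose coordinate changes are locally
  orientation-preserving isometries of \<open>H3\<close>.  As all 3-manifolds are orientable, the hyperbolic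
  structure is oriented by the atlas; both orientations are allowed.
\<close>

definition hyperbolic_atlas ::
    "'a::topological_space set \<Rightarrow> ('a set \<times> ('a \<Rightarrow> complex \<times> real)) set \<Rightarrow> bool" where
  "hyperbolic_atlas Y \<A> \<longleftrightarrow>
     \<Union> (fst ` \<A>) = Y \<and>
     (\<forall>(U, \<phi>) \<in> \<A>. openin (top_of_set Y) U \<and> open (\<phi> ` U) \<and> \<phi> ` U \<subseteq> H3 \<and>
        (\<exists>\<phi>'. homeomorphism U (\<phi> ` U) \<phi> \<phi>')) \<and>
     (\<forall>(U, \<phi>) \<in> \<A>. \<forall>(V, \<psi>) \<in> \<A>. \<forall>u \<in> U \<inter> V.
        \<exists>N. openin (top_of_set Y) N \<and> u \<in> N \<and> N \<subseteq> U \<inter> V \<and>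
          (\<exists>M \<in> carrier SL2C. \<forall>y\<in>N. \<psi> y = SL2C_action M (\<phi> y)))"

text \<open>
  A covering \<open>H3 \<rightarrow> Y\<close> which in every chart is locally an orientation-preserving isometry.
  As \<open>H3\<close> is simply connected, such a \<open>p\<close> exhibits \<open>H3\<close> as the universal cover of \<open>Y\<close>,
  and its inverse is a developing map; the structure is complete iff such a \<open>p\<close> exists.
\<close>

definition hyperbolic_universal_cover ::
    "'a::topological_space set \<Rightarrow> ('a set \<times> ('a \<Rightarrow> complex \<times> real)) set \<Rightarrow>
     (complex \<times> real \<Rightarrow> 'a) \<Rightarrow> bool" where
  "hyperbolic_universal_cover Y \<A> p \<longleftrightarrow>
     covering_space H3 p Y \<and>
     (\<forall>(U, \<phi>) \<in> \<A>. \<forall>x \<in> H3 \<inter> p -` U.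
        \<exists>N. open N \<and> x \<in> N \<and> N \<subseteq> H3 \<inter> p -` U \<and>
          (\<exists>M \<in> carrier SL2C. \<forall>x'\<in>N. \<phi> (p x') = SL2C_action M x'))"

text \<open>The Riemannian volume of \<open>Y\<close>: the Borel measure which in each chart is hyperbolic volume.\<close>

definition is_volume_measure ::
    "'a::topological_space set \<Rightarrow> ('a set \<times> ('a \<Rightarrow> complex \<times> real)) set \<Rightarrow> 'a measure \<Rightarrow> bool" where
  "is_volume_measure Y \<A> \<mu> \<longleftrightarrow>
     space \<mu> = Y \<and> sets \<mu> = sigma_sets Y {U. openin (top_of_set Y) U} \<and>
     (\<forall>(U, \<phi>) \<in> \<A>. \<forall>B \<in> sets \<mu>. B \<subseteq> U \<longrightarrow> emeasure \<mu> B = hyperbolic_volume (\<phi> ` B))"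

definition finite_volume_hyperbolic_3_manifold ::
    "'a::topological_space set \<Rightarrow> ('a set \<times> ('a \<Rightarrow> complex \<times> real)) set \<Rightarrow> bool" where
  "finite_volume_hyperbolic_3_manifold Y \<A> \<longleftrightarrow>
     Y \<noteq> {} \<and> connected Y \<and> Hausdorff_space (top_of_set Y) \<and> second_countable (top_of_set Y) \<and>
     hyperbolic_atlas Y \<A> \<and>
     (\<exists>p. hyperbolic_universal_cover Y \<A> p) \<and>
     (\<exists>\<mu>. is_volume_measure Y \<A> \<mu> \<and> emeasure \<mu> Y < \<infinity>)"


section \<open>Holonomy representations\<close>

text \<open>
  The holonomy of the loop \<open>g\<close> with respect to the universal cover \<open>p\<close> and the base point \<open>x0\<close>
  over \<open>y0\<close> is the deck transformation of \<open>p\<close> that sends \<open>x0\<close> to the end point of the lift of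
  \<open>g\<close> starting at \<open>x0\<close>.  The representation \<open>\<rho>0\<close> picks a lift to \<open>SL(2,C)\<close>, compatibly with
  products.  Varying \<open>p\<close> and \<open>x0\<close> accounts for the conjugation ambiguity.
\<close>

definition holonomy_representation ::
    "'a::topological_space set \<Rightarrow> ('a set \<times> ('a \<Rightarrow> complex \<times> real)) set \<Rightarrow> 'a \<Rightarrow>
     ((real \<Rightarrow> 'a) set \<Rightarrow> complex^2^2) \<Rightarrow> bool" where
  "holonomy_representation Y \<A> y0 \<rho>0 \<longleftrightarrow>
     \<rho>0 \<in> hom (fundamental_group Y y0) SL2C \<and>
     (\<exists>p x0. hyperbolic_universal_cover Y \<A> p \<and> x0 \<in> H3 \<and> p x0 = y0 \<and>
        (\<forall>g \<in> loops Y y0.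
           (\<forall>x\<in>H3. p (SL2C_action (\<rho>0 (loop_class Y g)) x) = p x) \<and>
           (\<exists>k. path k \<and> path_image k \<subseteq> H3 \<and> (\<forall>t\<in>{0..1}. p (k t) = g t) \<and>
                pathstart k = x0 \<and> pathfinish k = SL2C_action (\<rho>0 (loop_class Y g)) x0)))"


section \<open>Complex intervals\<close>

text \<open>The pair \<open>(I, J)\<close> stands for the rectangle \<open>{x + i y. x \<in> I, y \<in> J}\<close>.\<close>

type_synonym complex_interval = "rat interval \<times> rat interval"

definition rectangle :: "complex_interval \<Rightarrow> complex set" where
  "rectangle I = {z. Re z \<in> {of_rat (lower (fst I)) .. of_rat (upper (fst I))} \<and>
               Im z \<in> {of_rat (lower (snd I)) .. of_rat (upper (snd I))}}"

definition point_interval :: "rat \<Rightarrow> complex_interval" where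
  "point_interval q = (interval_of q, interval_of 0)"

text \<open>
  An interval arithmetic is not determined by the containment property that it has to satisfy
  (the smallest interval may not even have rational end points), so it is a parameter.
\<close>

record interval_arithmetic =
  iadd :: "complex_interval \<Rightarrow> complex_interval \<Rightarrow> complex_interval"
  isub :: "complex_interval \<Rightarrow> complex_interval \<Rightarrow> complex_interval"
  imul :: "complex_interval \<Rightarrow> complex_interval \<Rightarrow> complex_interval"
  idiv :: "complex_interval \<Rightarrow> complex_interval \<Rightarrow> complex_interval"
  iabs :: "complex_interval \<Rightarrow> real interval"
  radd :: "real interval \<Rightarrow> real interval \<Rightarrow> real interval"

definition is_interval_arithmetic :: "interval_arithmetic \<Rightarrow> bool" where
  "is_interval_arithmetic ar \<longleftrightarrow>
     (\<forall>I J. \<forall>x\<in>rectangle I. \<forall>y\<in>rectangle J.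
        x + y \<in> rectangle (iadd ar I J) \<and>
        x - y \<in> rectangle (isub ar I J) \<and>
        x * y \<in> rectangle (imul ar I J) \<and>
        (0 \<notin> rectangle J \<longrightarrow> x / y \<in> rectangle (idiv ar I J))) \<and>
     (\<forall>I. \<forall>x\<in>rectangle I. cmod x \<in> set_of (iabs ar I)) \<and>
     (\<forall>I J. \<forall>x\<in>set_of I. \<forall>y\<in>set_of J. x + y \<in> set_of (radd ar I J))"

type_synonym interval_matrix = "complex_interval^2^2"

definition mat_in :: "complex^2^2 \<Rightarrow> interval_matrix \<Rightarrow> bool" where
  "mat_in M A \<longleftrightarrow> (\<forall>i j. M$i$j \<in> rectangle (A$i$j))"

definition imat_one :: interval_matrix where
  "imat_one = (\<chi> i j. if i = j then point_interval 1 else point_interval 0)"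

definition imat_mult ::
    "interval_arithmetic \<Rightarrow> interval_matrix \<Rightarrow> interval_matrix \<Rightarrow> interval_matrix" where
  "imat_mult ar A B =
     (\<chi> i j. iadd ar (imul ar (A$i$1) (B$1$j)) (imul ar (A$i$2) (B$2$j)))"

definition imat_trace :: "interval_arithmetic \<Rightarrow> interval_matrix \<Rightarrow> complex_interval" where
  "imat_trace ar A = iadd ar (A$1$1) (A$2$2)"

definition imat_det :: "interval_arithmetic \<Rightarrow> interval_matrix \<Rightarrow> complex_interval" where
  "imat_det ar A = isub ar (imul ar (A$1$1) (A$2$2)) (imul ar (A$1$2) (A$2$1))"

definition imat_GL2 :: "interval_arithmetic \<Rightarrow> interval_matrix set" where
  "imat_GL2 ar = {A. 0 \<notin> rectangle (imat_det ar A)}"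

text \<open>The adjugate divided by the determinant; only meaningful on \<^const>\<open>imat_GL2\<close>.\<close>

definition imat_inverse :: "interval_arithmetic \<Rightarrow> interval_matrix \<Rightarrow> interval_matrix" where
  "imat_inverse ar A =
     (let D = imat_det ar A; neg = isub ar (point_interval 0)
      in \<chi> i j. if i = 1 \<and> j = 1 then idiv ar (A$2$2) D
                else if i = 1 \<and> j = 2 then idiv ar (neg (A$1$2)) D
                else if i = 2 \<and> j = 1 then idiv ar (neg (A$2$1)) D
                else idiv ar (A$1$1) D)"

definition imat_commutator ::
    "interval_arithmetic \<Rightarrow> interval_matrix \<Rightarrow> interval_matrix \<Rightarrow> interval_matrix" where
  "imat_commutator ar A B =
     imat_mult ar (imat_mult ar (imat_mult ar A B) (imat_inverse ar A)) (imat_inverse ar B)"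

text \<open>Interval multiplication need not be associative; products of words are bracketed to the left.\<close>

fun interval_word ::
    "interval_arithmetic \<Rightarrow> ('g \<Rightarrow> interval_matrix) \<Rightarrow> 'g list \<Rightarrow> interval_matrix" where
  "interval_word ar \<rho> [] = imat_one"
| "interval_word ar \<rho> (s # w) = foldl (imat_mult ar) (\<rho> s) (map \<rho> w)"

text \<open>The interval \<open>|tr^2 B - 4| + |tr [A, B] - 2|\<close>.\<close>

definition jorgensen_interval ::
    "interval_arithmetic \<Rightarrow> interval_matrix \<Rightarrow> interval_matrix \<Rightarrow> real interval" where
  "jorgensen_interval ar A B =
     radd ar
       (iabs ar (isub ar (imul ar (imat_trace ar B) (imat_trace ar B)) (point_interval 4)))
       (iabs ar (isub ar (imat_trace ar (imat_commutator ar A B)) (point_interval 2)))"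

definition approximate_holonomy_representation ::
    "interval_arithmetic \<Rightarrow> 'a::topological_space set \<Rightarrow>
     ('a set \<times> ('a \<Rightarrow> complex \<times> real)) set \<Rightarrow> 'a \<Rightarrow> (real \<Rightarrow> 'a) set set \<Rightarrow>
     ((real \<Rightarrow> 'a) set \<Rightarrow> interval_matrix) \<Rightarrow> bool" where
  "approximate_holonomy_representation ar Y \<A> y0 S \<rho> \<longleftrightarrow>
     (\<forall>s\<in>S. \<rho> s \<in> imat_GL2 ar) \<and>
     (\<exists>\<rho>0. holonomy_representation Y \<A> y0 \<rho>0 \<and> (\<forall>s\<in>S. mat_in (\<rho>0 s) (\<rho> s)))"

end

theory Submission
  imports Defs
begin

text \<open>
  Interval arithmetic only serves to transport inequalities.  If \<open>\<rho>0\<close> is a holonomy representation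
  contained in \<open>\<rho>\<close>, then \<open>B = \<rho>0 w\<close> and \<open>A\<^sub>i = \<rho>0 s\<^sub>i\<close> are honest matrices which satisfy
  \<open>|tr\<^sup>2 B - 4| + |tr [A\<^sub>i, B] - 2| < 1\<close> for both \<open>i\<close>, and \<open>tr [A\<^sub>1, A\<^sub>2] \<noteq> 2\<close>
  (\<open>jorgensen_interval_in\<close>, \<open>interval_word_in\<close>).  It suffices to show that
  \<open>B = 1\<close> and that \<open>\<rho>0\<close> is injective.

  The topology of \<open>Y\<close> enters through \<open>holonomy_group_discrete_faithful\<close>: the image \<open>\<Gamma>\<close> of \<open>\<rho>0\<close>
  acts on hyperbolic space by deck transformations of a covering, so it is discrete; and a loop
  whose holonomy fixes the base point has a closed lift, which is contractible because \<open>H3\<close> is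
  convex, so the loop is trivial.  In particular \<open>\<rho>0\<close> is injective and \<open>-1 \<notin> \<Gamma>\<close>, and therefore no
  element of \<open>\<Gamma>\<close> has trace \<open>0\<close>: its square would be \<open>-1\<close>.

  The algebraic part is the argument behind Jorgensen's inequality.  Suppose \<open>B \<noteq> 1\<close>, and bring \<open>B\<close>
  by conjugation into diagonal form or into the form of an upper triangular matrix with equal
  diagonal entries.  If \<open>A \<in> \<Gamma>\<close> satisfies the inequality, the iteration \<open>M \<mapsto> M B M\<inverse>\<close>, started at
  \<open>A\<close>, converges to \<open>B\<close>, in the diagonal case after a further conjugation by powers of \<open>B\<close>.
  Discreteness forces the sequence to reach the limit exactly, and tracing this back to \<open>A\<close>
  shows that \<open>A\<close> is upper triangular too (\<open>jorgensen_parabolic\<close>, \<open>jorgensen_diagonal\<close>).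
  Geometrically, \<open>A\<close> fixes a fixed point of \<open>B\<close> on the sphere at infinity that depends
  on \<open>B\<close> only.  So \<open>A\<^sub>1\<close> and \<open>A\<^sub>2\<close> are simultaneously upper triangular, which gives
  \<open>tr [A\<^sub>1, A\<^sub>2] = 2\<close>, a contradiction.
\<close>

section \<open>Two-by-two matrices of determinant one\<close>

definition mat2 :: "complex \<Rightarrow> complex \<Rightarrow> complex \<Rightarrow> complex \<Rightarrow> complex^2^2" where
  "mat2 a b c d = (\<chi> i j. if i = 1 then (if j = 1 then a else b) else (if j = 1 then c else d))"

lemma mat2_nth [simp]:
  "mat2 a b c d $ 1 $ 1 = a" "mat2 a b c d $ 1 $ 2 = b"
  "mat2 a b c d $ 2 $ 1 = c" "mat2 a b c d $ 2 $ 2 = d"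
  by (simp_all add: mat2_def)

lemma mat2_eq_iff [simp]:
  "mat2 a b c d = mat2 a' b' c' d' \<longleftrightarrow> a = a' \<and> b = b' \<and> c = c' \<and> d = d'"
  by (auto simp: vec_eq_iff forall_2)

lemma mat2_eta: "mat2 (M$1$1) (M$1$2) (M$2$1) (M$2$2) = M"
  by (simp add: vec_eq_iff forall_2)

lemma mat2_cases: obtains a b c d where "M = mat2 a b c d"
  by (metis mat2_eta)

lemma mat2_mult [simp]:
  "mat2 a b c d ** mat2 a' b' c' d' =
     mat2 (a * a' + b * c') (a * b' + b * d') (c * a' + d * c') (c * b' + d * d')"
  by (simp add: vec_eq_iff forall_2 matrix_matrix_mult_def sum_2)

lemma mat_eq_mat2: "(mat k :: complex^2^2) = mat2 k 0 0 k"
  by (simp add: vec_eq_iff forall_2 mat_def)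

lemma det_mat2 [simp]: "det (mat2 a b c d) = a * d - b * c"
  by (simp add: det_2)

lemma trace_mat2 [simp]: "trace (mat2 a b c d) = a + d"
  by (simp add: trace_def sum_2)

lemma tendsto_mat2_iff:
  "(M \<longlongrightarrow> mat2 a b c d) F \<longleftrightarrow>
     ((\<lambda>n. M n $ 1 $ 1) \<longlongrightarrow> a) F \<and> ((\<lambda>n. M n $ 1 $ 2) \<longlongrightarrow> b) F \<and>
     ((\<lambda>n. M n $ 2 $ 1) \<longlongrightarrow> c) F \<and> ((\<lambda>n. M n $ 2 $ 2) \<longlongrightarrow> d) F" (is "?l \<longleftrightarrow> ?r")
proof
  assume l: ?l
  have "((\<lambda>n. M n $ i $ j) \<longlongrightarrow> mat2 a b c d $ i $ j) F" for i j
    by (intro tendsto_vec_nth l)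
  from this[of 1 1] this[of 1 2] this[of 2 1] this[of 2 2] show ?r by simp
next
  assume r: ?r
  have "((\<lambda>n. M n $ i $ j) \<longlongrightarrow> mat2 a b c d $ i $ j) F" for i j
    using r exhaust_2[of i] exhaust_2[of j] by auto
  then show ?l by (intro vec_tendstoI)
qed

lemma tendsto_matrix_mult:
  fixes M N :: "'b \<Rightarrow> complex^2^2"
  assumes "(M \<longlongrightarrow> K) F" and "(N \<longlongrightarrow> L) F"
  shows "((\<lambda>n. M n ** N n) \<longlongrightarrow> K ** L) F"
  unfolding matrix_matrix_mult_def
  by (intro vec_tendstoI) (auto intro!: tendsto_intros assms)

text \<open>
  The adjugate is used as the inverse: on determinant one both agree, but the adjugate is polynomial
  in the entries, so that identities between matrices reduce to ring identities.
\<close>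

definition adj2 :: "complex^2^2 \<Rightarrow> complex^2^2" where
  "adj2 M = mat2 (M$2$2) (- M$1$2) (- M$2$1) (M$1$1)"

lemma adj2_mat2 [simp]: "adj2 (mat2 a b c d) = mat2 d (- b) (- c) a"
  by (simp add: adj2_def)

lemma adj2_adj2 [simp]: "adj2 (adj2 M) = M"
  by (cases M rule: mat2_cases) simp

lemma det_adj2 [simp]: "det (adj2 M) = det M"
  by (cases M rule: mat2_cases) (simp add: mult.commute)

lemma adj2_mult: "adj2 (M ** N) = adj2 N ** adj2 M"
  by (cases M rule: mat2_cases, cases N rule: mat2_cases) (simp add: algebra_simps)

lemma adj2_inverse: 
  assumes "det M = 1"
  shows "M ** adj2 M = mat 1" and "adj2 M ** M = mat 1"
  using assms by (cases M rule: mat2_cases; simp add: mat_eq_mat2 algebra_simps)+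

lemma adj2_unique:
  assumes "det M = 1" and "M ** N = mat 1" shows "N = adj2 M"
  by (metis adj2_inverse(2) assms matrix_mul_assoc matrix_mul_lid matrix_mul_rid)

text \<open>
  Conjugation by \<open>P\<close>, i.e. the change to the basis formed by the columns of \<open>P\<close>.
\<close>

definition conj2 :: "complex^2^2 \<Rightarrow> complex^2^2 \<Rightarrow> complex^2^2" where
  "conj2 P M = adj2 P ** M ** P"

lemma conj2_mult: 
  assumes "det P = 1" shows "conj2 P M ** conj2 P N = conj2 P (M ** N)"
proof -
  have "conj2 P M ** conj2 P N = adj2 P ** M ** (P ** adj2 P) ** N ** P"
    by (simp add: conj2_def matrix_mul_assoc)
  then show ?thesis using assms by (simp add: conj2_def matrix_mul_assoc adj2_inverse)
qed

lemma adj2_conj2: "adj2 (conj2 P M) = conj2 P (adj2 M)"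
  by (simp add: conj2_def adj2_mult matrix_mul_assoc)

lemma conj2_one: "det P = 1 \<Longrightarrow> conj2 P (mat 1) = mat 1"
  by (simp add: conj2_def adj2_inverse)

lemma conj2_conj2: "conj2 Q (conj2 P M) = conj2 (P ** Q) M"
  by (simp add: conj2_def adj2_mult matrix_mul_assoc)

lemma conj2_id: "conj2 (mat 1) M = M"
proof -
  have "adj2 (mat 1) = mat 1" by (simp add: mat_eq_mat2)
  then show ?thesis by (simp add: conj2_def)
qed

lemma conj2_adj2_cancel: "det P = 1 \<Longrightarrow> conj2 (adj2 P) (conj2 P M) = M"
  by (simp add: conj2_conj2 adj2_inverse conj2_id)

lemma det_conj2: "det P = 1 \<Longrightarrow> det (conj2 P M) = det M"
  by (simp add: conj2_def det_mul)

lemma trace_conj2: "det P = 1 \<Longrightarrow> trace (conj2 P M) = trace M"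
  by (metis adj2_inverse(1) conj2_def matrix_mul_assoc matrix_mul_lid trace_mul_sym)

lemma tendsto_conj2: "(X \<longlongrightarrow> L) F \<Longrightarrow> ((\<lambda>n. conj2 P (X n)) \<longlongrightarrow> conj2 P L) F"
  unfolding conj2_def by (intro tendsto_matrix_mult tendsto_const)

text \<open>
  An eigenvector of \<open>B\<close>, completed to a basis of determinant one, makes \<open>B\<close> upper triangular; if the
  eigenvalues differ, a further shear removes the entry above the diagonal.
\<close>

lemma normal_form_SL2:
  assumes "det B = 1"
  obtains P u v where "det P = 1" "u * v = 1" "u \<noteq> v" "conj2 P B = mat2 u 0 0 v"
  | P e t where "det P = 1" "e\<^sup>2 = 1" "conj2 P B = mat2 e t 0 e"
proof -
  obtain a b c d where B: "B = mat2 a b c d" by (rule mat2_cases)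
  have det: "a * d - b * c = 1" using assms B by simp
  have "\<exists>P u t v. det P = 1 \<and> u * v = 1 \<and> conj2 P B = mat2 u t 0 v"
  proof (cases "c = 0")
    case True
    then show ?thesis
      using det B by (intro exI[of _ "mat 1"] exI[of _ a] exI[of _ b] exI[of _ d]) (simp add: conj2_id)
  next
    case False
    \<comment> \<open>\<open>l\<close> is an eigenvalue, and \<open>(l - d, c)\<close> an eigenvector for it.\<close>
    define l where "l = ((a + d) + csqrt ((a + d)\<^sup>2 - 4)) / 2"
    have "2 * l - (a + d) = csqrt ((a + d)\<^sup>2 - 4)" by (simp add: l_def field_simps)
    then have "(2 * l - (a + d))\<^sup>2 = (a + d)\<^sup>2 - 4" by simp
    then have "4 * (l * l) = 4 * (l * (a + d) - 1)" by (simp add: power2_eq_square algebra_simps)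
    then have l: "l * l = l * (a + d) - 1" by (simp only: mult_cancel_left) simp
    show ?thesis
    proof (intro exI conjI)
      show "det (mat2 (l - d) (- 1 / c) c 0) = 1" using False by simp
      show "l * (a + d - l) = 1" using l by (simp add: algebra_simps)
      have "a * (l - d) + b * c = l * (l - d)" using det l by (simp add: algebra_simps)
      then have "c * (a * (l - d) + b * c) = c * (l * (l - d))" by simp
      with \<open>a * (l - d) + b * c = l * (l - d)\<close> show "conj2 (mat2 (l - d) (- 1 / c) c 0) B = mat2 l (- 1 / c) 0 (a + d - l)"
        using False unfolding B conj2_def by (simp add: algebra_simps)
    qed
  qed
  then obtain P u t v where P: "det P = 1" "u * v = 1" "conj2 P B = mat2 u t 0 v" by blast
  show thesis
  proof (cases "u = v")
    case True
    then show thesis using P that(2)[of P u t] by (simp add: power2_eq_square)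
  next
    case False
    define Q where "Q = mat2 1 (t / (v - u)) 0 1"
    have "conj2 (P ** Q) B = conj2 Q (mat2 u t 0 v)" by (simp add: P flip: conj2_conj2)
    also have "\<dots> = mat2 u 0 0 v" using False by (simp add: conj2_def Q_def field_simps)
    finally show thesis using False P that(1)[of "P ** Q" u v] by (simp add: det_mul Q_def)
  qed
qed

section \<open>Discrete groups of matrices\<close>

text \<open>
  Discreteness is stated as isolation of the identity, for sequences.  Excluding \<open>-1\<close> excludes all
  elements of order \<open>2\<close> in \<open>PSL(2,C)\<close>, by Cayley-Hamilton: a matrix of determinant \<open>1\<close> and trace \<open>0\<close>
  has square \<open>-1\<close>.
\<close>

locale discrete_SL2 =
  fixes \<Gamma> :: "(complex^2^2) set"
  assumes det_eq_1: "M \<in> \<Gamma> \<Longrightarrow> det M = 1"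
    and mult_closed: "M \<in> \<Gamma> \<Longrightarrow> N \<in> \<Gamma> \<Longrightarrow> M ** N \<in> \<Gamma>"
    and adj2_closed: "M \<in> \<Gamma> \<Longrightarrow> adj2 M \<in> \<Gamma>"
    and discrete: "(\<And>n. X n \<in> \<Gamma>) \<Longrightarrow> X \<longlonglongrightarrow> mat 1 \<Longrightarrow> \<forall>\<^sub>F n in sequentially. X n = mat 1"
    and minus_one_notin: "mat (- 1) \<notin> \<Gamma>"
begin

text \<open>
  Discreteness is used in this form: a sequence in the group that converges inside the
  group reaches its limit, since \<open>X n ** B\<inverse>\<close> tends to the identity.
\<close>

lemma limit_attained:
  assumes X: "\<And>n. X n \<in> \<Gamma>" and B: "B \<in> \<Gamma>" and lim: "X \<longlonglongrightarrow> B"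
  shows "\<exists>n. X n = B"
proof -
  have "(\<lambda>n. X n ** adj2 B) \<longlonglongrightarrow> mat 1"
    using tendsto_matrix_mult[OF lim tendsto_const, of "adj2 B"] adj2_inverse(1)[OF det_eq_1[OF B]]
    by simp
  then have "\<forall>\<^sub>F n in sequentially. X n ** adj2 B = mat 1"
    by (intro discrete mult_closed X adj2_closed B)
  then obtain n where "X n ** adj2 B = mat 1"
    using eventually_happens'[OF sequentially_bot] by blast
  then have "X n = B"
    using adj2_unique[OF det_eq_1[OF X[of n]]] adj2_adj2 by metis
  then show ?thesis by blast
qed

lemma trace_nonzero:
  assumes "M \<in> \<Gamma>" shows "trace M \<noteq> 0"
proof
  assume tr: "trace M = 0"
  obtain a b c d where M: "M = mat2 a b c d" by (rule mat2_cases)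
  have d: "d = - a" using tr M by (simp add: add_eq_0_iff)
  have "a * d - b * c = 1" using det_eq_1[OF assms] M by simp
  then have "a * a + b * c = - 1" using d by (simp add: algebra_simps) algebra
  then have "M ** M = mat (- 1)" using d by (auto simp: M mat_eq_mat2 add.commute mult.commute)
  then show False using mult_closed[OF assms assms] minus_one_notin by simp
qed

lemma conj_discrete_SL2:
  assumes P: "det P = 1" shows "discrete_SL2 (conj2 P ` \<Gamma>)"
proof
  show "det M = 1" if "M \<in> conj2 P ` \<Gamma>" for M
    using that P by (auto simp: det_conj2 det_eq_1)
  show "M ** N \<in> conj2 P ` \<Gamma>" if "M \<in> conj2 P ` \<Gamma>" "N \<in> conj2 P ` \<Gamma>" for M N
    using that P by (auto simp: conj2_mult intro!: imageI mult_closed)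
  show "adj2 M \<in> conj2 P ` \<Gamma>" if "M \<in> conj2 P ` \<Gamma>" for M
    using that by (auto simp: adj2_conj2 intro!: imageI adj2_closed)
  have "conj2 P M \<noteq> mat (- 1)" if "M \<in> \<Gamma>" for M
  proof
    assume "conj2 P M = mat (- 1)"
    then have "M = conj2 (adj2 P) (mat (- 1))" using conj2_adj2_cancel[OF P, of M] by simp
    also have "\<dots> = mat (- 1)"
      using P by (cases P rule: mat2_cases) (simp add: conj2_def mat_eq_mat2 algebra_simps)
    finally show False using that minus_one_notin by simp
  qed
  then show "mat (- 1) \<notin> conj2 P ` \<Gamma>" by (metis imageE)
  fix X assume X: "\<And>n. X n \<in> conj2 P ` \<Gamma>" and lim: "X \<longlonglongrightarrow> mat 1"
  have "(\<lambda>n. conj2 (adj2 P) (X n)) \<longlonglongrightarrow> mat 1"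
    using tendsto_conj2[OF lim, of "adj2 P"] P by (simp add: conj2_one)
  moreover have "conj2 (adj2 P) (X n) \<in> \<Gamma>" for n
    using X[of n] P by (auto simp: conj2_adj2_cancel)
  ultimately have "\<forall>\<^sub>F n in sequentially. conj2 (adj2 P) (X n) = mat 1"
    by (intro discrete)
  then show "\<forall>\<^sub>F n in sequentially. X n = mat 1"
  proof eventually_elim
    case (elim n)
    then show ?case 
      using conj2_adj2_cancel[of "adj2 P" "X n"] P by (simp add: conj2_one)
  qed
qed

end

section \<open>Jorgensen's inequality\<close>

text \<open>
  The left-hand side of Jorgensen's inequality \<open>|tr\<^sup>2 B - 4| + |tr [A, B] - 2| \<ge> 1\<close>.
\<close>

definition jorgensen_number :: "complex^2^2 \<Rightarrow> complex^2^2 \<Rightarrow> real" where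
  "jorgensen_number A B =
     cmod ((trace B)\<^sup>2 - 4) + cmod (trace (A ** B ** adj2 A ** adj2 B) - 2)"

lemma jorgensen_number_conj2:
  "det P = 1 \<Longrightarrow> jorgensen_number (conj2 P A) (conj2 P B) = jorgensen_number A B"
  by (simp add: jorgensen_number_def adj2_conj2 conj2_mult trace_conj2)

definition jorgensen_seq :: "complex^2^2 \<Rightarrow> complex^2^2 \<Rightarrow> nat \<Rightarrow> complex^2^2" where
  "jorgensen_seq B A n = ((\<lambda>M. M ** B ** adj2 M) ^^ n) A"

lemma jorgensen_seq_simps:
  "jorgensen_seq B A 0 = A"
  "jorgensen_seq B A (Suc n) = jorgensen_seq B A n ** B ** adj2 (jorgensen_seq B A n)"
  by (simp_all add: jorgensen_seq_def)

lemma (in discrete_SL2) jorgensen_seq_mem: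
  "A \<in> \<Gamma> \<Longrightarrow> B \<in> \<Gamma> \<Longrightarrow> jorgensen_seq B A n \<in> \<Gamma>"
  by (induction n) (auto simp: jorgensen_seq_simps intro: mult_closed adj2_closed)

text \<open>
  The Shimizu-Leutbecher argument.  The lower left entries \<open>c\<close> of the sequence satisfy
  \<open>c' = - t c\<^sup>2\<close>, and the hypothesis says \<open>|t c| < 1\<close> at the start.  Hence \<open>c\<close> tends to \<open>0\<close>, the
  sequence converges to the given triangular matrix and, by discreteness, reaches it.  So some
  \<open>c\<close> is \<open>0\<close>, and the recurrence then gives \<open>c = 0\<close> at the start.
\<close>

lemma (in discrete_SL2) jorgensen_parabolic:
  assumes B: "mat2 e t 0 e \<in> \<Gamma>" and t: "t \<noteq> 0" and A: "A \<in> \<Gamma>"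
    and less: "jorgensen_number A (mat2 e t 0 e) < 1"
  shows "A $ 2 $ 1 = 0"
proof -
  define Z where "Z = jorgensen_seq (mat2 e t 0 e) A"
  define a b c d where "a = (\<lambda>n. Z n $ 1 $ 1)" and "b = (\<lambda>n. Z n $ 1 $ 2)"
    and "c = (\<lambda>n. Z n $ 2 $ 1)" and "d = (\<lambda>n. Z n $ 2 $ 2)"
  have Z: "Z n = mat2 (a n) (b n) (c n) (d n)" for n
    by (simp add: a_def b_def c_def d_def mat2_eta)
  have Z_mem: "Z n \<in> \<Gamma>" for n unfolding Z_def by (intro jorgensen_seq_mem A B)
  have ee: "e * e = 1" using det_eq_1[OF B] by simp
  have det: "a n * d n - b n * c n = 1" for n using det_eq_1[OF Z_mem[of n]] by (simp add: Z)
  have ad: "a n * d n = 1 + b n * c n" for n using det[of n] by (simp add: algebra_simps)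
  \<comment> \<open>The multiple of \<open>c\<close> that is invariant under diagonal conjugation; it satisfies \<open>x' = - x\<^sup>2\<close>.\<close>
  define x where "x = (\<lambda>n. t * c n)"
  have rec: "Z (Suc n) = mat2 (e - x n * a n) (t * (a n)\<^sup>2) (- (x n * c n)) (e + x n * a n)" for n
  proof -
    have "Z (Suc n) = Z n ** mat2 e t 0 e ** adj2 (Z n)" by (simp add: Z_def jorgensen_seq_simps)
    moreover have "e * (a n * d n) = e + e * (b n * c n)" by (simp add: ad algebra_simps)
    ultimately show ?thesis
      by (simp add: Z x_def power2_eq_square) (simp add: algebra_simps)
  qed
  have a_Suc: "a (Suc n) = e - x n * a n" and b_Suc: "b (Suc n) = t * (a n)\<^sup>2"
    and c_Suc: "c (Suc n) = - (x n * c n)" and d_Suc: "d (Suc n) = e + x n * a n" for n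
    using rec[of n] by (simp_all add: a_def b_def c_def d_def)
  define r where "r = cmod (x 0)"
  have "trace (A ** mat2 e t 0 e ** adj2 A ** adj2 (mat2 e t 0 e)) = 2 + (x 0)\<^sup>2"
  proof -
    have "A ** mat2 e t 0 e ** adj2 A = Z (Suc 0)" by (simp add: Z_def jorgensen_seq_simps)
    then show ?thesis
      using ee by (simp add: rec x_def power2_eq_square algebra_simps)
  qed
  then have "r\<^sup>2 < 1"
    using less norm_ge_zero[of "(trace (mat2 e t 0 e))\<^sup>2 - 4"]
    unfolding jorgensen_number_def r_def by (simp add: norm_power del: norm_ge_zero)
  then have r: "r < 1" "r \<ge> 0" by (auto simp: power2_less_1_iff r_def abs_square_less_1)
  have x_Suc: "x (Suc n) = - (x n)\<^sup>2" for n by (simp add: x_def c_Suc power2_eq_square)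
  have x_bound: "cmod (x n) \<le> r * r ^ n" for n
  proof (induction n)
    case (Suc n)
    have "cmod (x n) \<le> r" using Suc r mult_left_le[of "r ^ n" r] by (simp add: power_le_one)
    then have "cmod (x (Suc n)) \<le> r * cmod (x n)"
      by (simp add: x_Suc norm_mult power2_eq_square mult_right_mono)
    also have "\<dots> \<le> r * (r * r ^ n)" using Suc r by (intro mult_left_mono)
    finally show ?case by simp
  qed (simp add: r_def)
  \<comment> \<open>The fixed point of \<open>k \<mapsto> 1 + r k\<close>, enlarged so as to bound the first term as well.\<close>
  define K where "K = cmod (a 0) + 1 / (1 - r)"
  have e1: "cmod e = 1" using ee by (auto simp: square_eq_1_iff)
  have a_bound: "cmod (a n) \<le> K" for n
  proof (induction n)
    case 0
    then show ?case using r by (simp add: K_def)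
  next
    case (Suc n)
    have "cmod (x n) \<le> r" using x_bound[of n] r mult_left_le[of "r ^ n" r] by (simp add: power_le_one)
    then have "cmod (x n * a n) \<le> r * K"
      unfolding norm_mult by (intro mult_mono Suc r) auto
    then have "cmod (a (Suc n)) \<le> 1 + r * K"
      unfolding a_Suc using norm_triangle_ineq4[of e "x n * a n"] e1 by simp
    also have "\<dots> = r * cmod (a 0) + 1 / (1 - r)" using r by (simp add: K_def field_simps)
    also have "\<dots> \<le> K" using r mult_right_mono[of r 1 "cmod (a 0)"] by (simp add: K_def)
    finally show ?case .
  qed
  have K0: "K \<ge> 0" using a_bound[of 0] norm_ge_zero[of "a 0"] by linarith
  have geom: "(\<lambda>n. C * r ^ n) \<longlonglongrightarrow> 0" for C :: real
    using tendsto_mult_right_zero[OF LIMSEQ_power_zero[of r]] r by simp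
  have xa: "(\<lambda>n. x n * a n) \<longlonglongrightarrow> 0"
  proof (rule Lim_null_comparison[OF always_eventually geom[of "r * K"]], rule allI)
    show "cmod (x n * a n) \<le> r * K * r ^ n" for n
      using mult_mono[OF x_bound[of n] a_bound[of n]] r K0 by (simp add: norm_mult algebra_simps)
  qed
  have x_lim: "x \<longlonglongrightarrow> 0"
    by (rule Lim_null_comparison[OF always_eventually geom[of r]]) (use x_bound in blast)
  have "(\<lambda>n. a (Suc n)) \<longlonglongrightarrow> e - 0" unfolding a_Suc by (intro tendsto_intros xa)
  then have a_lim: "a \<longlonglongrightarrow> e" by (simp add: filterlim_sequentially_Suc)
  have "(\<lambda>n. b (Suc n)) \<longlonglongrightarrow> t * e\<^sup>2" unfolding b_Suc by (intro tendsto_intros a_lim)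
  then have b_lim: "b \<longlonglongrightarrow> t" using ee by (simp add: filterlim_sequentially_Suc power2_eq_square)
  have "(\<lambda>n. x n / t) \<longlonglongrightarrow> 0 / t" by (intro tendsto_intros x_lim t)
  then have c_lim: "c \<longlonglongrightarrow> 0" using t by (simp add: x_def)
  have "(\<lambda>n. d (Suc n)) \<longlonglongrightarrow> e + 0" unfolding d_Suc by (intro tendsto_intros xa)
  then have d_lim: "d \<longlonglongrightarrow> e" by (simp add: filterlim_sequentially_Suc)
  have "Z \<longlonglongrightarrow> mat2 e t 0 e"
    unfolding tendsto_mat2_iff using a_lim b_lim c_lim d_lim by (simp add: a_def b_def c_def d_def)
  then obtain n where "Z n = mat2 e t 0 e"
    using limit_attained[of Z, OF Z_mem B] by blast
  then have "c n = 0" by (simp add: c_def)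
  then have "c 0 = 0" using t by (induction n) (auto simp: c_Suc x_def)
  then show ?thesis by (simp add: c_def Z_def jorgensen_seq_simps)
qed

lemma tendsto_zero_of_ratio:
  fixes z k :: "nat \<Rightarrow> complex"
  assumes rec: "\<And>n. z (Suc n) = z n * k n" and k: "k \<longlonglongrightarrow> L" and L: "cmod L < 1"
  shows "z \<longlonglongrightarrow> 0"
proof -
  obtain q where q: "cmod L < q" "q < 1" using L dense by blast
  have "\<forall>\<^sub>F n in sequentially. cmod (k n) < q"
    by (rule order_tendstoD(2)[OF tendsto_norm[OF k] q(1)])
  then obtain N where N: "\<And>n. n \<ge> N \<Longrightarrow> cmod (k n) < q"
    by (auto simp: eventually_sequentially)
  have "summable z"
  proof (rule summable_ratio_test[OF q(2)])
    show "cmod (z (Suc n)) \<le> q * cmod (z n)" if "n \<ge> N" for n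
      using mult_right_mono[OF less_imp_le[OF N[OF that]], of "cmod (z n)"]
      by (simp add: rec norm_mult mult.commute)
  qed
  then show ?thesis by (rule summable_LIMSEQ_zero)
qed

text \<open>
  Jorgensen's argument.  With \<open>\<delta> = u - v\<close>, the products \<open>x\<close> of the off-diagonal entries of the
  sequence satisfy \<open>x' = - x (1 + x) \<delta>\<^sup>2\<close>, and the hypothesis says \<open>|\<delta>|\<^sup>2 (1 + |x|) < 1\<close> at the
  start, so \<open>x\<close> tends to \<open>0\<close> geometrically and the diagonal entries tend to \<open>u\<close> and \<open>v\<close>.  The
  single off-diagonal entries need not converge, but \<open>b n v\<^sup>n\<close> and \<open>c n u\<^sup>n\<close> tend to \<open>0\<close>, because
  their successive quotients tend to \<open>\<plusminus> \<delta>\<close>.  Conjugation of the term with index \<open>2 n\<close> by the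
  \<open>n\<close>-th power of the diagonal matrix produces exactly these rescaled entries and stays in the
  group.
\<close>

lemma (in discrete_SL2) jorgensen_diagonal:
  assumes B: "mat2 u 0 0 v \<in> \<Gamma>" and uv: "u \<noteq> v" and A: "A \<in> \<Gamma>"
    and less: "jorgensen_number A (mat2 u 0 0 v) < 1"
  shows "A $ 1 $ 2 = 0 \<and> A $ 2 $ 1 = 0"
proof -
  define Z where "Z = jorgensen_seq (mat2 u 0 0 v) A"
  define a b c d where "a = (\<lambda>n. Z n $ 1 $ 1)" and "b = (\<lambda>n. Z n $ 1 $ 2)"
    and "c = (\<lambda>n. Z n $ 2 $ 1)" and "d = (\<lambda>n. Z n $ 2 $ 2)"
  have Z: "Z n = mat2 (a n) (b n) (c n) (d n)" for n
    by (simp add: a_def b_def c_def d_def mat2_eta)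
  have Z_mem: "Z n \<in> \<Gamma>" for n unfolding Z_def by (intro jorgensen_seq_mem A B)
  have inv: "u * v = 1" using det_eq_1[OF B] by simp
  have ad: "a n * d n = 1 + b n * c n" for n
    using det_eq_1[OF Z_mem[of n]] by (simp add: Z algebra_simps)
  define \<delta> where "\<delta> = u - v"
  define x where "x = (\<lambda>n. b n * c n)"
  have rec: "Z (Suc n) = mat2 (u + x n * \<delta>) (- (a n * b n * \<delta>)) (c n * d n * \<delta>) (v - x n * \<delta>)" for n
  proof -
    have "Z (Suc n) = Z n ** mat2 u 0 0 v ** adj2 (Z n)" by (simp add: Z_def jorgensen_seq_simps)
    moreover have "u * (a n * d n) = u + u * (b n * c n)" "v * (a n * d n) = v + v * (b n * c n)"
      by (simp_all add: ad algebra_simps)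
    ultimately show ?thesis
      by (simp add: Z x_def \<delta>_def) (simp add: algebra_simps)
  qed
  have a_Suc: "a (Suc n) = u + x n * \<delta>" and b_Suc: "b (Suc n) = - (a n * b n * \<delta>)"
    and c_Suc: "c (Suc n) = c n * d n * \<delta>" and d_Suc: "d (Suc n) = v - x n * \<delta>" for n
    using rec[of n] by (simp_all add: a_def b_def c_def d_def)
  define q where "q = (cmod \<delta>)\<^sup>2 * (1 + cmod (x 0))"
  have "trace (A ** mat2 u 0 0 v ** adj2 A ** adj2 (mat2 u 0 0 v)) - 2 = - (x 0 * \<delta>\<^sup>2)"
  proof -
    have "A ** mat2 u 0 0 v ** adj2 A = Z (Suc 0)" by (simp add: Z_def jorgensen_seq_simps)
    then show ?thesis
      using inv by (simp add: rec power2_eq_square) (simp add: \<delta>_def algebra_simps)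
  qed
  moreover have "(trace (mat2 u 0 0 v))\<^sup>2 - 4 = \<delta>\<^sup>2"
    using inv by (simp add: \<delta>_def power2_eq_square algebra_simps)
  ultimately have "jorgensen_number A (mat2 u 0 0 v) = q"
    unfolding jorgensen_number_def by (simp only: norm_minus_cancel)
      (simp add: q_def norm_mult norm_power algebra_simps)
  then have q: "q < 1" "q \<ge> 0" using less by (simp_all add: q_def)
  have "(cmod \<delta>)\<^sup>2 * 1 \<le> q" unfolding q_def by (intro mult_left_mono) auto
  then have \<delta>: "cmod \<delta> < 1" using q abs_square_less_1[of "cmod \<delta>"] by simp
  have x_Suc: "x (Suc n) = - (x n * (1 + x n) * \<delta>\<^sup>2)" for n
    using ad[of n] by (simp add: x_def b_Suc c_Suc power2_eq_square flip: ad) 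
  have x_bound: "cmod (x n) \<le> cmod (x 0) * q ^ n" for n
  proof (induction n)
    case (Suc n)
    have "cmod (x n) \<le> cmod (x 0)"
      using Suc q mult_left_le[of "q ^ n" "cmod (x 0)"] by (simp add: power_le_one)
    then have "cmod (1 + x n) \<le> 1 + cmod (x 0)"
      using norm_triangle_ineq[of 1 "x n"] by simp
    then have "(cmod \<delta>)\<^sup>2 * cmod (1 + x n) \<le> q" unfolding q_def by (intro mult_left_mono) auto
    then have "cmod (x n) * ((cmod \<delta>)\<^sup>2 * cmod (1 + x n)) \<le> (cmod (x 0) * q ^ n) * q"
      by (intro mult_mono Suc) (use q in auto)
    moreover have "cmod (x (Suc n)) = cmod (x n) * ((cmod \<delta>)\<^sup>2 * cmod (1 + x n))"
      by (simp add: x_Suc norm_mult norm_power)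
    ultimately show ?case by (simp add: mult_ac)
  qed simp
  have x_lim: "x \<longlonglongrightarrow> 0"
  proof (rule Lim_null_comparison[OF always_eventually])
    show "(\<lambda>n. cmod (x 0) * q ^ n) \<longlonglongrightarrow> 0"
      using tendsto_mult_right_zero[OF LIMSEQ_power_zero[of q]] q by simp
  qed (use x_bound in blast)
  have "(\<lambda>n. a (Suc n)) \<longlonglongrightarrow> u + 0 * \<delta>" unfolding a_Suc by (intro tendsto_intros x_lim)
  then have a_lim: "a \<longlonglongrightarrow> u" by (simp add: filterlim_sequentially_Suc)
  have "(\<lambda>n. d (Suc n)) \<longlonglongrightarrow> v - 0 * \<delta>" unfolding d_Suc by (intro tendsto_intros x_lim)
  then have d_lim: "d \<longlonglongrightarrow> v" by (simp add: filterlim_sequentially_Suc)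
  have b_lim: "(\<lambda>n. b n * v ^ n) \<longlonglongrightarrow> 0"
  proof (rule tendsto_zero_of_ratio)
    show "(\<lambda>n. - (a n * v * \<delta>)) \<longlonglongrightarrow> - (u * v * \<delta>)" by (intro tendsto_intros a_lim)
  qed (use inv \<delta> in \<open>simp_all add: b_Suc\<close>)
  have c_lim: "(\<lambda>n. c n * u ^ n) \<longlonglongrightarrow> 0"
  proof (rule tendsto_zero_of_ratio)
    show "(\<lambda>n. d n * u * \<delta>) \<longlonglongrightarrow> v * u * \<delta>" by (intro tendsto_intros d_lim)
  qed (use inv \<delta> in \<open>simp_all add: c_Suc mult.commute\<close>)
  \<comment> \<open>Only even indices can be rescaled: conjugation by the \<open>n\<close>-th power of \<open>diag(u, v)\<close>
    multiplies the upper right entry by \<open>v\<^sup>2\<^sup>n\<close>.\<close>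
  have even: "(\<lambda>n. f (2 * n)) \<longlonglongrightarrow> L" if "f \<longlonglongrightarrow> L" for f :: "nat \<Rightarrow> complex" and L
    using LIMSEQ_subseq_LIMSEQ[OF that, of "\<lambda>n. 2 * n"] by (simp add: strict_mono_def comp_def)
  define D where "D = (\<lambda>n. mat2 (u ^ n) 0 0 (v ^ n))"
  have D_mem: "D n \<in> \<Gamma>" for n
  proof (induction n)
    case 0
    have "D 0 = A ** adj2 A" using adj2_inverse(1)[OF det_eq_1[OF A]] by (simp add: D_def mat_eq_mat2)
    then show ?case using mult_closed[OF A adj2_closed[OF A]] by simp
  next
    case (Suc n)
    have "D (Suc n) = mat2 u 0 0 v ** D n" by (simp add: D_def)
    then show ?case using mult_closed[OF B Suc] by simp
  qed
  have uvn: "u ^ n * v ^ n = 1" for n using inv by (simp flip: power_mult_distrib)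
  have conj_Z: "conj2 (D n) (Z (2 * n)) =
      mat2 (a (2 * n)) (b (2 * n) * v ^ (2 * n)) (c (2 * n) * u ^ (2 * n)) (d (2 * n))" for n
    using uvn[of n] by (simp add: Z D_def conj2_def mult_2 power_add) (simp add: algebra_simps)
  have "(\<lambda>n. conj2 (D n) (Z (2 * n))) \<longlonglongrightarrow> mat2 u 0 0 v"
    unfolding tendsto_mat2_iff conj_Z mat2_nth
    using even[OF a_lim] even[OF b_lim] even[OF c_lim] even[OF d_lim] by simp
  moreover have "conj2 (D n) (Z (2 * n)) \<in> \<Gamma>" for n
    unfolding conj2_def by (intro mult_closed adj2_closed D_mem Z_mem)
  ultimately obtain n where "conj2 (D n) (Z (2 * n)) = mat2 u 0 0 v"
    using limit_attained[of "\<lambda>n. conj2 (D n) (Z (2 * n))", OF _ B] by blast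
  then have "b (2 * n) = 0 \<and> c (2 * n) = 0"
    using inv by (auto simp: conj_Z)
  \<comment> \<open>Descent to index \<open>0\<close>.  If \<open>M\<close> conjugates \<open>diag(u, v)\<close> to a diagonal matrix, then \<open>M\<close> is diagonal
    or antidiagonal, and an antidiagonal matrix has trace \<open>0\<close>.\<close>
  moreover have "b m = 0 \<and> c m = 0" if "b (Suc m) = 0 \<and> c (Suc m) = 0" for m
  proof -
    have "a m * b m = 0" "c m * d m = 0" using that uv by (auto simp: b_Suc c_Suc \<delta>_def)
    moreover have "a m + d m \<noteq> 0" using trace_nonzero[OF Z_mem[of m]] by (simp add: Z)
    ultimately show ?thesis using ad[of m] by auto
  qed
  note descent = this
  have "b m = 0 \<and> c m = 0 \<Longrightarrow> b 0 = 0 \<and> c 0 = 0" for m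
    by (induction m) (use descent in blast)+
  ultimately have "b 0 = 0 \<and> c 0 = 0" by blast
  then show ?thesis by (simp add: b_def c_def Z_def jorgensen_seq_simps)
qed

text \<open>
  The matrix \<open>P\<close> brings \<open>B\<close> into normal form.  What matters is that it does not depend on \<open>A\<close>: its
  first column is a common eigenvector of all \<open>A\<close> that satisfy the inequality.
\<close>

lemma (in discrete_SL2) jorgensen_common_fixed_point:
  assumes B: "B \<in> \<Gamma>" "B \<noteq> mat 1"
  obtains P where "det P = 1"
    and "\<And>A. A \<in> \<Gamma> \<Longrightarrow> jorgensen_number A B < 1 \<Longrightarrow> conj2 P A $ 2 $ 1 = 0"
proof -
  from det_eq_1[OF B(1)] show thesis
  proof (cases rule: normal_form_SL2)
    case (1 P u v)
    interpret C: discrete_SL2 "conj2 P ` \<Gamma>" by (rule conj_discrete_SL2[OF 1(1)])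
    show thesis
    proof (rule that[OF 1(1)])
      fix A assume "A \<in> \<Gamma>" "jorgensen_number A B < 1"
      then show "conj2 P A $ 2 $ 1 = 0"
        using C.jorgensen_diagonal[of u v "conj2 P A"] B 1 jorgensen_number_conj2[OF 1(1), of A B]
        by (metis imageI)
    qed
  next
    case (2 P e t)
    interpret C: discrete_SL2 "conj2 P ` \<Gamma>" by (rule conj_discrete_SL2[OF 2(1)])
    have "t \<noteq> 0"
    proof
      assume "t = 0"
      then have "conj2 P B = mat e" using 2 by (simp add: mat_eq_mat2)
      moreover have "e = 1 \<or> e = - 1" using 2 by (simp add: power2_eq_1_iff)
      moreover have "conj2 P B \<noteq> mat 1"
        using conj2_adj2_cancel[OF 2(1), of B] B(2) 2(1) conj2_one[of "adj2 P"] by auto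
      moreover have "conj2 P B \<noteq> mat (- 1)" using C.minus_one_notin B(1) by (metis imageI)
      ultimately show False by auto
    qed
    show thesis
    proof (rule that[OF 2(1)])
      fix A assume "A \<in> \<Gamma>" "jorgensen_number A B < 1"
      then show "conj2 P A $ 2 $ 1 = 0"
        using C.jorgensen_parabolic[of e t "conj2 P A"] B 2 \<open>t \<noteq> 0\<close> jorgensen_number_conj2[OF 2(1), of A B]
        by (metis imageI)
    qed
  qed
qed

lemma trace_commutator_upper_triangular:
  assumes "det M = 1" "det N = 1" "M $ 2 $ 1 = 0" "N $ 2 $ 1 = 0"
  shows "trace (M ** N ** adj2 M ** adj2 N) = 2"
proof -
  have "M = mat2 (M$1$1) (M$1$2) 0 (M$2$2)" "N = mat2 (N$1$1) (N$1$2) 0 (N$2$2)"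
    using assms mat2_eta[of M] mat2_eta[of N] by simp_all
  then obtain a b d a' b' d' where M: "M = mat2 a b 0 d" "N = mat2 a' b' 0 d'" by metis
  then have "a * d = 1" "a' * d' = 1" using assms by simp_all
  then have "(a * d) * (a' * d') = 1" by simp
  then show ?thesis by (simp add: M algebra_simps)
qed

theorem (in discrete_SL2) jorgensen_two_generators:
  assumes "A1 \<in> \<Gamma>" "A2 \<in> \<Gamma>" "B \<in> \<Gamma>"
    and "jorgensen_number A1 B < 1" "jorgensen_number A2 B < 1"
    and tr: "trace (A1 ** A2 ** adj2 A1 ** adj2 A2) \<noteq> 2"
  shows "B = mat 1"
proof (rule ccontr)
  assume "B \<noteq> mat 1"
  then obtain P where P: "det P = 1"
    and fix_pt: "\<And>A. A \<in> \<Gamma> \<Longrightarrow> jorgensen_number A B < 1 \<Longrightarrow> conj2 P A $ 2 $ 1 = 0"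
    using jorgensen_common_fixed_point assms by metis
  have "trace (conj2 P A1 ** conj2 P A2 ** adj2 (conj2 P A1) ** adj2 (conj2 P A2)) = 2"
    by (intro trace_commutator_upper_triangular fix_pt assms) (simp_all add: det_conj2 P det_eq_1 assms)
  then show False using tr P by (simp add: adj2_conj2 conj2_mult trace_conj2)
qed

section \<open>The fundamental group is a group\<close>

lemma loop_class_eq_iff:
  assumes "g \<in> loops Y y0" "h \<in> loops Y y0"
  shows "loop_class Y g = loop_class Y h \<longleftrightarrow> homotopic_paths Y g h"
proof
  have "h \<in> loop_class Y h" using assms by (simp add: loop_class_def loops_def)
  then show "homotopic_paths Y g h" if "loop_class Y g = loop_class Y h"
    using that by (auto simp: loop_class_def)
  show "loop_class Y g = loop_class Y h" if "homotopic_paths Y g h"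
    using that homotopic_paths_trans homotopic_paths_sym unfolding loop_class_def by blast
qed

lemma loops_join: "g \<in> loops Y y0 \<Longrightarrow> h \<in> loops Y y0 \<Longrightarrow> g +++ h \<in> loops Y y0"
  by (auto simp: loops_def path_image_join)

lemma loops_reverse: "g \<in> loops Y y0 \<Longrightarrow> reversepath g \<in> loops Y y0"
  by (auto simp: loops_def)

lemma loops_const: "y0 \<in> Y \<Longrightarrow> (\<lambda>_. y0) \<in> loops Y y0"
  by (auto simp: loops_def path_def path_image_def pathstart_def pathfinish_def)

lemma mult_loop_class:
  assumes g: "g \<in> loops Y y0" and h: "h \<in> loops Y y0"
  shows "loop_class Y g \<otimes>\<^bsub>fundamental_group Y y0\<^esub> loop_class Y h = loop_class Y (g +++ h)"
proof -
  have "(\<exists>g'\<in>loop_class Y g. \<exists>h'\<in>loop_class Y h. homotopic_paths Y (g' +++ h') k) \<longleftrightarrow>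
      k \<in> loop_class Y (g +++ h)" (is "?l \<longleftrightarrow> ?r") for k
  proof
    assume ?l
    then obtain g' h' where *: "homotopic_paths Y g g'" "homotopic_paths Y h h'"
        "homotopic_paths Y (g' +++ h') k"
      by (auto simp: loop_class_def)
    have "homotopic_paths Y (g +++ h) (g' +++ h')"
      using homotopic_paths_join[OF *(1,2)] g h by (simp add: loops_def)
    then show ?r using homotopic_paths_trans[OF _ *(3)] by (simp add: loop_class_def)
  next
    assume ?r
    moreover have "g \<in> loop_class Y g" "h \<in> loop_class Y h"
      using g h by (simp_all add: loop_class_def loops_def)
    ultimately show ?l
      by (intro bexI[of _ g] bexI[of _ h]) (simp_all add: loop_class_def)
  qed
  then show ?thesis by (auto simp: fundamental_group_def)
qed

text \<open>
  A path \<open>g\<close> is the image under \<open>g\<close> of the straight path in \<open>{0..1}\<close>.  Hence the homotopies in the real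
  line between joins of straight paths map to homotopies in an arbitrary topological space.
\<close>

lemma homotopic_paths_const_join:
  fixes g :: "real \<Rightarrow> 'a::topological_space"
  assumes g: "path g" "path_image g \<subseteq> Y"
  shows "homotopic_paths Y ((\<lambda>_. pathstart g) +++ g) g"
proof -
  have "homotopic_paths {0..1::real} (linepath 0 0 +++ linepath 0 1) (linepath 0 1)"
    using homotopic_paths_lid[of "linepath 0 (1::real)" "{0..1}"]
    by (simp add: closed_segment_eq_real_ivl)
  then have "homotopic_paths Y (g \<circ> (linepath 0 0 +++ linepath 0 1)) (g \<circ> linepath 0 1)"
    using g by (intro homotopic_paths_continuous_image) (auto simp: path_def path_image_def)
  moreover have "g \<circ> linepath 0 0 = (\<lambda>_. pathstart g)" "g \<circ> linepath 0 1 = g"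
    by (simp_all add: fun_eq_iff linepath_def pathstart_def)
  ultimately show ?thesis by (simp add: path_compose_join)
qed

lemma homotopic_paths_reversepath_join:
  fixes g :: "real \<Rightarrow> 'a::topological_space"
  assumes g: "path g" "path_image g \<subseteq> Y"
  shows "homotopic_paths Y (reversepath g +++ g) (\<lambda>_. pathfinish g)"
proof -
  have "homotopic_paths {0..1::real} (linepath 1 0 +++ linepath 0 1) (linepath 1 1)"
    using homotopic_paths_linv[of "linepath 0 (1::real)" "{0..1}"]
    by (simp add: closed_segment_eq_real_ivl)
  then have "homotopic_paths Y (g \<circ> (linepath 1 0 +++ linepath 0 1)) (g \<circ> linepath 1 1)"
    using g by (intro homotopic_paths_continuous_image) (auto simp: path_def path_image_def)
  moreover have "g \<circ> linepath 1 1 = (\<lambda>_. pathfinish g)" "g \<circ> linepath 0 1 = g"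
      "g \<circ> linepath 1 0 = reversepath g"
    by (simp_all add: fun_eq_iff linepath_def pathfinish_def reversepath_def)
  ultimately show ?thesis by (simp add: path_compose_join)
qed

lemma group_fundamental_group:
  fixes Y :: "'a::topological_space set"
  assumes y0: "y0 \<in> Y"
  shows "group (fundamental_group Y y0)"
proof (rule groupI)
  let ?G = "fundamental_group Y y0"
  have carrier: "carrier ?G = loop_class Y ` loops Y y0"
    and one: "\<one>\<^bsub>?G\<^esub> = loop_class Y (\<lambda>_. y0)"
    by (simp_all add: fundamental_group_def)
  note mult = mult_loop_class
  show "\<one>\<^bsub>?G\<^esub> \<in> carrier ?G" using loops_const[OF y0] by (simp add: carrier one)
  fix a assume "a \<in> carrier ?G"
  then obtain g where g: "a = loop_class Y g" "g \<in> loops Y y0" by (auto simp: carrier)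
  show "a \<otimes>\<^bsub>?G\<^esub> b \<in> carrier ?G" if "b \<in> carrier ?G" for b
    using that g by (auto simp: carrier mult intro!: imageI loops_join)
  show "a \<otimes>\<^bsub>?G\<^esub> b \<otimes>\<^bsub>?G\<^esub> c = a \<otimes>\<^bsub>?G\<^esub> (b \<otimes>\<^bsub>?G\<^esub> c)"
    if bc: "b \<in> carrier ?G" "c \<in> carrier ?G" for b c
  proof -
    obtain h k where hk: "b = loop_class Y h" "h \<in> loops Y y0" "c = loop_class Y k" "k \<in> loops Y y0"
      using bc by (auto simp: carrier)
    then have "homotopic_paths Y (g +++ (h +++ k)) ((g +++ h) +++ k)"
      using g by (intro homotopic_paths_assoc) (auto simp: loops_def)
    then show ?thesis
      using g hk by (simp add: mult loops_join loop_class_eq_iff[of _ _ y0] homotopic_paths_sym)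
  qed
  show "\<one>\<^bsub>?G\<^esub> \<otimes>\<^bsub>?G\<^esub> a = a"
  proof -
    have "homotopic_paths Y ((\<lambda>_. y0) +++ g) g"
      using homotopic_paths_const_join[of g Y] g by (simp add: loops_def)
    then show ?thesis
      using g y0 by (simp add: one mult loops_join loops_const loop_class_eq_iff[of _ _ y0])
  qed
  show "\<exists>b\<in>carrier ?G. b \<otimes>\<^bsub>?G\<^esub> a = \<one>\<^bsub>?G\<^esub>"
  proof
    have "homotopic_paths Y (reversepath g +++ g) (\<lambda>_. y0)"
      using homotopic_paths_reversepath_join[of g Y] g by (simp add: loops_def)
    then show "loop_class Y (reversepath g) \<otimes>\<^bsub>?G\<^esub> a = \<one>\<^bsub>?G\<^esub>"
      using g y0
      by (simp add: one mult loops_join loops_reverse loops_const loop_class_eq_iff[of _ _ y0])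
    show "loop_class Y (reversepath g) \<in> carrier ?G" using g by (simp add: carrier loops_reverse)
  qed
qed

section \<open>Lifts and deck transformations\<close>

lemma H3_eq_Times: "H3 = UNIV \<times> {0<..}"
  by (auto simp: H3_def)

lemma convex_H3: "convex H3"
  unfolding H3_eq_Times by (intro convex_Times convex_UNIV convex_real_interval)

text \<open>
  Continuity of the action at the identity, which turns convergence of matrices into convergence of
  orbit points.
\<close>

lemma tendsto_SL2C_action_one:
  assumes lim: "X \<longlonglongrightarrow> mat 1" and x: "x \<in> H3"
  shows "(\<lambda>n. SL2C_action (X n) x) \<longlonglongrightarrow> x"
proof -
  obtain z t where zt: "x = (z, t)" by (cases x)
  have e: "(\<lambda>n. X n $ 1 $ 1) \<longlonglongrightarrow> 1" "(\<lambda>n. X n $ 1 $ 2) \<longlonglongrightarrow> 0"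
      "(\<lambda>n. X n $ 2 $ 1) \<longlonglongrightarrow> 0" "(\<lambda>n. X n $ 2 $ 2) \<longlonglongrightarrow> 1"
    using lim by (simp_all add: mat_eq_mat2 tendsto_mat2_iff)
  have "(\<lambda>n. SL2C_action (X n) x) \<longlonglongrightarrow>
     (((1 * z + 0) * cnj (0 * z + 1) + 1 * cnj 0 * complex_of_real (t\<^sup>2)) /
        complex_of_real ((cmod (0 * z + 1))\<^sup>2 + (cmod 0)\<^sup>2 * t\<^sup>2),
      t / ((cmod (0 * z + 1))\<^sup>2 + (cmod 0)\<^sup>2 * t\<^sup>2))"
    unfolding SL2C_action_def Let_def zt fst_conv snd_conv
    by (intro tendsto_intros e) auto
  then show ?thesis by (simp add: zt)
qed

lemma SL2C_action_minus_one: "SL2C_action (mat (- 1)) x = x"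
  by (simp add: SL2C_action_def Let_def mat_eq_mat2)

text \<open>
  The covering space \<open>H3\<close> is convex, so the closed lift is null-homotopic there; the homotopy is
  pushed down by \<open>p\<close>.
\<close>

lemma homotopic_const_of_closed_lift:
  fixes p :: "complex \<times> real \<Rightarrow> 'a::topological_space"
  assumes p: "continuous_on H3 p" "p ` H3 = Y"
    and k: "path k" "path_image k \<subseteq> H3" "pathstart k = x0" "pathfinish k = x0"
    and lift: "\<forall>t\<in>{0..1}. p (k t) = g t"
  shows "homotopic_paths Y g (\<lambda>_. p x0)"
proof -
  have "homotopic_paths H3 k (linepath x0 x0)"
    using convex_imp_simply_connected[OF convex_H3] k simply_connected_eq_contractible_path by blast
  then have "homotopic_paths Y (p \<circ> k) (p \<circ> linepath x0 x0)"
    using p by (intro homotopic_paths_continuous_image) auto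
  moreover have "p \<circ> linepath x0 x0 = (\<lambda>_. p x0)" by (simp add: fun_eq_iff linepath_refl)
  moreover have "homotopic_paths Y (p \<circ> k) g"
    using k p lift
    by (intro homotopic_paths_eq path_continuous_image)
      (auto simp: path_image_compose intro: continuous_on_subset)
  ultimately show ?thesis by (metis homotopic_paths_sym homotopic_paths_trans)
qed

lemma covering_space_locally_injective:
  assumes cov: "covering_space C p S" and x: "x \<in> C"
  obtains U where "openin (top_of_set C) U" "x \<in> U" "inj_on p U"
proof -
  have "p x \<in> S" using cov x by (auto simp: covering_space_def)
  then obtain T v where T: "p x \<in> T" and v: "\<Union>v = C \<inter> p -` T"
      "\<forall>u \<in> v. openin (top_of_set C) u" "\<forall>u \<in> v. \<exists>q. homeomorphism u T p q"
    using cov unfolding covering_space_def by meson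
  obtain u where "u \<in> v" "x \<in> u" using T v(1) x by blast
  moreover obtain q where "homeomorphism u T p q" using v(3) \<open>u \<in> v\<close> by blast
  then have "inj_on p u" by (intro inj_on_inverseI[of _ q]) (rule homeomorphism_apply1)
  ultimately show thesis using that v(2) by blast
qed

section \<open>The holonomy group\<close>

context
  fixes G :: "('g, 'b) monoid_scheme" and \<phi> :: "'g \<Rightarrow> complex^2^2"
  assumes G: "group G" and hom: "\<phi> \<in> hom G SL2C"
begin

lemma hom_SL2C_det: "x \<in> carrier G \<Longrightarrow> det (\<phi> x) = 1"
  using hom by (auto simp: hom_def SL2C_def)

lemma hom_SL2C_mult: "x \<in> carrier G \<Longrightarrow> y \<in> carrier G \<Longrightarrow> \<phi> (x \<otimes>\<^bsub>G\<^esub> y) = \<phi> x ** \<phi> y"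
  using hom by (auto simp: hom_def SL2C_def)

lemma hom_SL2C_one: "\<phi> \<one>\<^bsub>G\<^esub> = mat 1"
proof -
  interpret group G by (rule G)
  have "\<phi> \<one>\<^bsub>G\<^esub> ** \<phi> \<one>\<^bsub>G\<^esub> = \<phi> \<one>\<^bsub>G\<^esub>" using hom_SL2C_mult[of "\<one>\<^bsub>G\<^esub>" "\<one>\<^bsub>G\<^esub>"] by simp
  then show ?thesis
    by (metis adj2_inverse(2) hom_SL2C_det matrix_mul_assoc matrix_mul_lid one_closed)
qed

lemma hom_SL2C_inv: "x \<in> carrier G \<Longrightarrow> \<phi> (inv\<^bsub>G\<^esub> x) = adj2 (\<phi> x)"
proof -
  interpret group G by (rule G)
  show "x \<in> carrier G \<Longrightarrow> \<phi> (inv\<^bsub>G\<^esub> x) = adj2 (\<phi> x)"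
    using hom_SL2C_mult[of x "inv\<^bsub>G\<^esub> x"] by (intro adj2_unique) (simp_all add: hom_SL2C_det hom_SL2C_one)
qed

lemma word_value_closed: "set w \<subseteq> carrier G \<Longrightarrow> word_value G w \<in> carrier G"
proof -
  interpret group G by (rule G)
  show "set w \<subseteq> carrier G \<Longrightarrow> word_value G w \<in> carrier G"
    by (induction w) (auto simp: word_value_def)
qed

lemma foldl_hom_SL2C:
  "set w \<subseteq> carrier G \<Longrightarrow> foldl (**) M (map \<phi> w) = M ** \<phi> (word_value G w)"
proof (induction w arbitrary: M)
  case Nil
  then show ?case by (simp add: word_value_def hom_SL2C_one)
next
  case (Cons s w)
  have "word_value G (s # w) = s \<otimes>\<^bsub>G\<^esub> word_value G w" by (simp add: word_value_def)
  then show ?case using Cons by (simp add: hom_SL2C_mult word_value_closed matrix_mul_assoc)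
qed

end

text \<open>
  If matrices \<open>\<rho>0 x\<close> tend to the identity, they eventually move the base point \<open>x0\<close> within a
  neighbourhood on which the covering is injective.  Since the image of \<open>x0\<close> lies over the same
  point as \<open>x0\<close>, it equals \<open>x0\<close>.  Then the lift that joins them is closed, and the loop is trivial.
\<close>

lemma holonomy_group_discrete_faithful:
  fixes Y :: "'a::topological_space set"
  assumes hol: "holonomy_representation Y \<A> y0 \<rho>0" and y0: "y0 \<in> Y"
  defines "G \<equiv> fundamental_group Y y0"
  shows "discrete_SL2 (\<rho>0 ` carrier G)"
    and "\<And>x. x \<in> carrier G \<Longrightarrow> \<rho>0 x = mat 1 \<Longrightarrow> x = \<one>\<^bsub>G\<^esub>"
proof -
  interpret group G unfolding G_def by (rule group_fundamental_group[OF y0])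
  have hom: "\<rho>0 \<in> hom G SL2C" using hol by (simp add: holonomy_representation_def G_def)
  note hom_simps = hom_SL2C_det[OF is_group hom] hom_SL2C_mult[OF is_group hom]
    hom_SL2C_one[OF is_group hom] hom_SL2C_inv[OF is_group hom]
  obtain p x0 where ucov: "hyperbolic_universal_cover Y \<A> p" and x0: "x0 \<in> H3" "p x0 = y0"
    and hol_loop: "\<forall>g \<in> loops Y y0.
           (\<forall>x\<in>H3. p (SL2C_action (\<rho>0 (loop_class Y g)) x) = p x) \<and>
           (\<exists>k. path k \<and> path_image k \<subseteq> H3 \<and> (\<forall>t\<in>{0..1}. p (k t) = g t) \<and>
                pathstart k = x0 \<and> pathfinish k = SL2C_action (\<rho>0 (loop_class Y g)) x0)"
    using hol unfolding holonomy_representation_def by (elim conjE exE)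
  have cov: "covering_space H3 p Y" using ucov by (simp add: hyperbolic_universal_cover_def)
  note deck = bspec[OF hol_loop, THEN conjunct1] and lift = bspec[OF hol_loop, THEN conjunct2]
  have p: "continuous_on H3 p" "p ` H3 = Y" using cov by (simp_all add: covering_space_def)
  have carrier: "carrier G = loop_class Y ` loops Y y0" by (simp add: G_def fundamental_group_def)
  \<comment> \<open>Freeness of the action at \<open>x0\<close>; both discreteness and injectivity reduce to it.\<close>
  have free: "x = \<one>\<^bsub>G\<^esub>" if "x \<in> carrier G" and fixed: "SL2C_action (\<rho>0 x) x0 = x0" for x
  proof -
    obtain g where g: "g \<in> loops Y y0" "x = loop_class Y g" using \<open>x \<in> carrier G\<close> carrier by blast
    obtain k where "path k" "path_image k \<subseteq> H3" "\<forall>t\<in>{0..1}. p (k t) = g t"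
        "pathstart k = x0" "pathfinish k = x0"
      using lift[OF g(1)] fixed g(2) by auto
    then have "homotopic_paths Y g (\<lambda>_. p x0)" using homotopic_const_of_closed_lift[OF p] by blast
    then have "loop_class Y g = loop_class Y (\<lambda>_. y0)"
      using loop_class_eq_iff[OF g(1) loops_const[OF y0]] x0 by simp
    then show ?thesis using g by (simp add: G_def fundamental_group_def)
  qed
  show "x = \<one>\<^bsub>G\<^esub>" if "x \<in> carrier G" "\<rho>0 x = mat 1" for x
    using that by (intro free) (simp_all add: SL2C_action_def Let_def mat_eq_mat2)
  show "discrete_SL2 (\<rho>0 ` carrier G)"
  proof
    show "det M = 1" if "M \<in> \<rho>0 ` carrier G" for M using that by (auto simp: hom_simps)
    show "M ** N \<in> \<rho>0 ` carrier G" if "M \<in> \<rho>0 ` carrier G" "N \<in> \<rho>0 ` carrier G" for M N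
      using that by (auto simp flip: hom_simps(2))
    show "adj2 M \<in> \<rho>0 ` carrier G" if "M \<in> \<rho>0 ` carrier G" for M
      using that by (auto simp flip: hom_simps(4))
    show "mat (- 1) \<notin> \<rho>0 ` carrier G"
    proof
      assume "mat (- 1) \<in> \<rho>0 ` carrier G"
      then obtain x where x: "x \<in> carrier G" "\<rho>0 x = mat (- 1)" by auto
      then have "x = \<one>\<^bsub>G\<^esub>" by (intro free) (simp_all add: SL2C_action_minus_one)
      then show False using x hom_simps(3) by (simp add: mat_eq_mat2)
    qed
    fix X assume X: "\<And>n. X n \<in> \<rho>0 ` carrier G" and lim: "X \<longlonglongrightarrow> mat 1"
    obtain U where U: "openin (top_of_set H3) U" "x0 \<in> U" "inj_on p U"
      using covering_space_locally_injective[OF cov x0(1)] .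
    obtain V where V: "open V" "U = H3 \<inter> V" using U(1) by (auto simp: openin_open)
    have "\<forall>\<^sub>F n in sequentially. SL2C_action (X n) x0 \<in> V"
      using topological_tendstoD[OF tendsto_SL2C_action_one[OF lim x0(1)] V(1)] U V by blast
    then show "\<forall>\<^sub>F n in sequentially. X n = mat 1"
    proof eventually_elim
      case (elim n)
      obtain x where x: "x \<in> carrier G" "X n = \<rho>0 x" using X by blast
      obtain g where g: "g \<in> loops Y y0" "x = loop_class Y g" using x carrier by blast
      have "SL2C_action (X n) x0 \<in> H3"
        using lift[OF g(1)] pathfinish_in_path_image x g by (metis subsetD)
      moreover have "p (SL2C_action (X n) x0) = p x0" using deck[OF g(1)] x g x0 by simp
      ultimately have "SL2C_action (X n) x0 = x0" using U V elim by (auto dest: inj_onD)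
      then show ?case using free x hom_simps(3) by auto
    qed
  qed
qed

section \<open>Interval arithmetic contains exact arithmetic\<close>

lemma mat_in_eq:
  "mat_in M A \<longleftrightarrow> M$1$1 \<in> rectangle (A$1$1) \<and> M$1$2 \<in> rectangle (A$1$2) \<and>
     M$2$1 \<in> rectangle (A$2$1) \<and> M$2$2 \<in> rectangle (A$2$2)"
  by (auto simp: mat_in_def forall_2)

lemma point_interval_rectangle: "of_rat q \<in> rectangle (point_interval q)"
proof (cases q)
  case (Fract a b)
  then have "of_rat q = complex_of_real (of_rat q)" by (simp add: of_rat_rat)
  then show ?thesis by (simp add: rectangle_def point_interval_def)
qed

context
  fixes ar assumes ar: "is_interval_arithmetic ar"
begin

lemma
  assumes "x \<in> rectangle I" "y \<in> rectangle J"
  shows iadd_in: "x + y \<in> rectangle (iadd ar I J)"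
    and isub_in: "x - y \<in> rectangle (isub ar I J)"
    and imul_in: "x * y \<in> rectangle (imul ar I J)"
    and idiv_in: "0 \<notin> rectangle J \<Longrightarrow> x / y \<in> rectangle (idiv ar I J)"
  using ar assms unfolding is_interval_arithmetic_def by blast+

lemma imat_mult_in:
  assumes "mat_in M A" "mat_in N B" shows "mat_in (M ** N) (imat_mult ar A B)"
  using assms by (auto simp: mat_in_eq imat_mult_def matrix_matrix_mult_def sum_2 intro!: iadd_in imul_in)

lemma imat_trace_in: "mat_in M A \<Longrightarrow> trace M \<in> rectangle (imat_trace ar A)"
  by (auto simp: mat_in_eq imat_trace_def trace_def sum_2 intro!: iadd_in)

lemma imat_det_in: "mat_in M A \<Longrightarrow> det M \<in> rectangle (imat_det ar A)"
  by (auto simp: mat_in_eq imat_det_def det_2 intro!: isub_in imul_in)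

text \<open>
  The exact determinant is \<open>1\<close>, so dividing the adjugate by it changes nothing, while the interval
  division needs the determinant interval to avoid \<open>0\<close>.
\<close>

lemma imat_inverse_in:
  assumes M: "mat_in M A" and det: "det M = 1" and A: "A \<in> imat_GL2 ar"
  shows "mat_in (adj2 M) (imat_inverse ar A)"
proof -
  have div: "x \<in> rectangle (idiv ar I (imat_det ar A))" if "x \<in> rectangle I" for x I
    using idiv_in[OF that imat_det_in[OF M]] A det by (simp add: imat_GL2_def)
  have neg: "- x \<in> rectangle (isub ar (point_interval 0) I)" if "x \<in> rectangle I" for x I
    using isub_in[OF point_interval_rectangle[of 0] that] by simp
  show ?thesis
    using M by (auto simp: mat_in_eq imat_inverse_def Let_def adj2_def intro!: div neg)
qed

text \<open>
  Interval products of words are bracketed to the left; by associativity the exact product may be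
  bracketed in the same way.
\<close>

lemma interval_word_in:
  assumes G: "group G" and hom: "\<phi> \<in> hom G SL2C" and w: "set w \<subseteq> carrier G"
    and S: "\<forall>s\<in>set w. mat_in (\<phi> s) (\<rho> s)"
  shows "mat_in (\<phi> (word_value G w)) (interval_word ar \<rho> w)"
proof (cases w)
  case Nil
  then show ?thesis
    using point_interval_rectangle[of 0] point_interval_rectangle[of 1]
    by (simp add: word_value_def hom_SL2C_one[OF G hom] mat_in_eq imat_one_def mat_eq_mat2)
next
  case (Cons s v)
  have foldl_in: "mat_in (foldl (**) M (map \<phi> v)) (foldl (imat_mult ar) A (map \<rho> v))"
    if "mat_in M A" "\<forall>s\<in>set v. mat_in (\<phi> s) (\<rho> s)" for M A v
    using that by (induction v arbitrary: M A) (auto intro: imat_mult_in)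
  have "\<phi> (word_value G w) = \<phi> s ** \<phi> (word_value G v)"
    using w Cons by (simp add: word_value_def hom_SL2C_mult[OF G hom] word_value_closed[OF G hom, unfolded word_value_def])
  also have "\<dots> = foldl (**) (\<phi> s) (map \<phi> v)"
    using w Cons by (simp add: foldl_hom_SL2C[OF G hom])
  finally show ?thesis using foldl_in S Cons by simp
qed

lemma jorgensen_interval_in:
  assumes M: "mat_in M A" "det M = 1" "A \<in> imat_GL2 ar"
    and N: "mat_in N B" "det N = 1" "B \<in> imat_GL2 ar"
  shows "jorgensen_number M N \<in> set_of (jorgensen_interval ar A B)"
proof -
  have "mat_in (M ** N ** adj2 M ** adj2 N) (imat_commutator ar A B)"
    unfolding imat_commutator_def by (intro imat_mult_in imat_inverse_in M N)
  then have "trace (M ** N ** adj2 M ** adj2 N) - 2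
      \<in> rectangle (isub ar (imat_trace ar (imat_commutator ar A B)) (point_interval 2))"
    using isub_in[OF imat_trace_in point_interval_rectangle[of 2]] by simp
  moreover have "(trace N)\<^sup>2 - 4
      \<in> rectangle (isub ar (imul ar (imat_trace ar B) (imat_trace ar B)) (point_interval 4))"
    using isub_in[OF imul_in[OF imat_trace_in[OF N(1)] imat_trace_in[OF N(1)]] point_interval_rectangle[of 4]]
    by (simp add: power2_eq_square)
  ultimately show ?thesis
    using ar unfolding jorgensen_interval_def jorgensen_number_def is_interval_arithmetic_def by blast
qed

end

section \<open>Words with small Jorgensen number are trivial\<close>

theorem theorem6p1:
  fixes Y :: "'a::topological_space set"
    and \<A> :: "('a set \<times> ('a \<Rightarrow> complex \<times> real)) set"
    and y0 :: 'a
    and ar :: interval_arithmetic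
    and S :: "(real \<Rightarrow> 'a) set set"
    and \<rho> :: "(real \<Rightarrow> 'a) set \<Rightarrow> interval_matrix"
    and s1 s2 :: "(real \<Rightarrow> 'a) set"
    and w :: "(real \<Rightarrow> 'a) set list"
  assumes "finite_volume_hyperbolic_3_manifold Y \<A>" and "y0 \<in> Y"
    and "finite S" and "symmetric_generating_set (fundamental_group Y y0) S"
    and "is_interval_arithmetic ar"
    and "approximate_holonomy_representation ar Y \<A> y0 S \<rho>"
    and "s1 \<in> S" and "s2 \<in> S"
    and "2 \<notin> rectangle (imat_trace ar (interval_word ar \<rho>
           [s1, s2, inv\<^bsub>fundamental_group Y y0\<^esub> s1, inv\<^bsub>fundamental_group Y y0\<^esub> s2]))"
    and "set w \<subseteq> S"
    and "interval_word ar \<rho> w \<in> imat_GL2 ar"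
    and "\<forall>s\<in>{s1, s2}.
           lower (jorgensen_interval ar (\<rho> s) (interval_word ar \<rho> w)) < 1 \<and>
           upper (jorgensen_interval ar (\<rho> s) (interval_word ar \<rho> w)) < 1"
  shows "word_value (fundamental_group Y y0) w = \<one>\<^bsub>fundamental_group Y y0\<^esub>"
proof -
  let ?G = "fundamental_group Y y0"
  note ar = \<open>is_interval_arithmetic ar\<close>
  have group: "group ?G" using group_fundamental_group[OF \<open>y0 \<in> Y\<close>] .
  obtain \<rho>0 where hol: "holonomy_representation Y \<A> y0 \<rho>0"
    and \<rho>0: "\<And>s. s \<in> S \<Longrightarrow> mat_in (\<rho>0 s) (\<rho> s)" and \<rho>_GL2: "\<And>s. s \<in> S \<Longrightarrow> \<rho> s \<in> imat_GL2 ar"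
    using assms(6) unfolding approximate_holonomy_representation_def by blast
  have S: "S \<subseteq> carrier ?G" "\<And>s. s \<in> S \<Longrightarrow> inv\<^bsub>?G\<^esub> s \<in> S"
    using assms(4) by (auto simp: symmetric_generating_set_def)
  have hom: "\<rho>0 \<in> hom ?G SL2C" using hol by (simp add: holonomy_representation_def)
  interpret \<Gamma>: discrete_SL2 "\<rho>0 ` carrier ?G"
    by (rule holonomy_group_discrete_faithful(1)[OF hol \<open>y0 \<in> Y\<close>])
  have word_in: "mat_in (\<rho>0 (word_value ?G v)) (interval_word ar \<rho> v)" if "set v \<subseteq> S" for v
    using that S \<rho>0 by (intro interval_word_in[OF ar group hom]) auto
  have w: "word_value ?G w \<in> carrier ?G"
    using assms(10) S by (intro word_value_closed[OF group hom]) auto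
  have s: "s1 \<in> carrier ?G" "s2 \<in> carrier ?G" using assms(7,8) S by auto
  have less: "jorgensen_number (\<rho>0 s) (\<rho>0 (word_value ?G w)) < 1" if "s \<in> {s1, s2}" for s
  proof -
    have "s \<in> S" using that assms(7,8) by auto
    then have "jorgensen_number (\<rho>0 s) (\<rho>0 (word_value ?G w))
        \<in> set_of (jorgensen_interval ar (\<rho> s) (interval_word ar \<rho> w))"
      using S w assms(10,11)
      by (intro jorgensen_interval_in[OF ar] \<rho>0 \<rho>_GL2 word_in hom_SL2C_det[OF group hom]) auto
    then show ?thesis using assms(12) that by (force simp: set_of_eq)
  qed
  have "\<rho>0 (word_value ?G [s1, s2, inv\<^bsub>?G\<^esub> s1, inv\<^bsub>?G\<^esub> s2]) =
      \<rho>0 s1 ** \<rho>0 s2 ** adj2 (\<rho>0 s1) ** adj2 (\<rho>0 s2)"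
  proof -
    have "set [s1, s2, inv\<^bsub>?G\<^esub> s1, inv\<^bsub>?G\<^esub> s2] \<subseteq> carrier ?G" using S assms(7,8) by auto
    from foldl_hom_SL2C[OF group hom this, of "mat 1"] show ?thesis
      using s by (simp add: hom_SL2C_inv[OF group hom])
  qed
  moreover have "mat_in (\<rho>0 (word_value ?G [s1, s2, inv\<^bsub>?G\<^esub> s1, inv\<^bsub>?G\<^esub> s2]))
      (interval_word ar \<rho> [s1, s2, inv\<^bsub>?G\<^esub> s1, inv\<^bsub>?G\<^esub> s2])"
    using S assms(7,8) by (intro word_in) auto
  ultimately have "trace (\<rho>0 s1 ** \<rho>0 s2 ** adj2 (\<rho>0 s1) ** adj2 (\<rho>0 s2)) \<noteq> 2"
    using imat_trace_in[OF ar] assms(9) by metis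
  then have "\<rho>0 (word_value ?G w) = mat 1"
    using s w less by (intro \<Gamma>.jorgensen_two_generators[of "\<rho>0 s1" "\<rho>0 s2"]) auto
  then show ?thesis
    using holonomy_group_discrete_faithful(2)[OF hol \<open>y0 \<in> Y\<close>] w by blast
qed

end
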